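(* Let $\beta>0$, let $H$ be a separable Hilbert space with nuclear rigging $H_*\to H\to H^*$, and let $(\Omega,\Sigma,dP)$ be a probability space. Let $\{\mathbf G^\beta(\omega,\cdot)\}_{\omega\in\Omega}$ be a weakly $\Sigma$-measurable family of thermal $\beta$-KMS Green functionals on $C_r(K_\beta)\otimes H_*$ obeying, for $P$-almost every $\omega\in\Omega$, properties G(1), G(2), G(3), together with the regularity condition, the latter holding uniformly in $\omega$ a.e. on $\Omega$. Then the functional $$\mathbf G^\beta_P(\psi\otimes f)=\int_\Omega dP(\omega)\,\mathbf G^\beta(\omega,\psi\otimes f)$$ obeys G(1), G(2) and G(3).
   Context: $K_\beta$ is the circle of length $\beta$, modelled as the interval $[-\beta/2,\beta/2]$ with endpoints glued; $C_r(K_\beta)$ is the space of real-valued continuous functions on $K_\beta$. A nuclear rigging of $H$ is a triple $H_*\to H\to H^*$ with $H_*$ a nuclear space densely and continuously embedded in $H$ and $H^*$ its dual. $R$ denotes reflection on $K_\beta$, $(R\psi)(s)=\psi(-s)$; shifts act by $(T_t\psi)(s)=\psi(s-t)$ (modulo $\beta$). Both act on the first tensor factor of $C_r(K_\beta)\otimes H_*$. A thermal $\beta$-KMS Green functional is the functional $$\mathbf G(\psi\otimes f)=\mathbb E\exp\Bigl(i\int_{-\beta/2}^{\beta/2}d\tau\,\psi(\tau)\langle\zeta_\tau,f\rangle\Bigr),\qquad \psi\in C_r(K_\beta),\ f\in H_*,$$ of a stochastic process $\zeta_\tau$ indexed by $\tau\in K_\beta$ (a thermal process), whose path space measure is carried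 by the rigging and for which the $\langle\zeta_\tau,f\rangle$ are real random variables. The exponent is extended linearly, so that $\mathbf G$ is also defined on differences of simple tensors, and $\mathbf G^\beta_P$ is defined on these by the same integral over $\Omega$. Properties of such a functional $\mathbf G$: G(1) (S-positivity) for all $n$ and all $c_\alpha\in\mathbb C$, $\psi_\alpha\in C_r(K_\beta)$, $f_\alpha\in H_*$, $\alpha=1,\dots,n$: $\sum_{\alpha,\gamma}\overline{c_\alpha}\,c_\gamma\,\mathbf G(\psi_\alpha\otimes f_\alpha-\psi_\gamma\otimes f_\gamma)\ge0$; G(2) (reflection positivity) for all $n$ and all $c_\alpha\in\mathbb C$, $f_\alpha\in H_*$ and $\psi_\alpha\in C_r(K_\beta)$ supported in $[0,\beta/2]$, $\alpha=1,\dots,n$: $\sum_{\alpha,\gamma}\overline{c_\alpha}\,c_\gamma\,\mathbf G(\psi_\alpha\otimes f_\alpha-R\psi_\gamma\otimes f_\gamma)\ge0$; G(3) $\mathbf G$ is reflection invariant, $K_\beta$-shift invariant and $\beta$-periodic. The regularity condition is the additional continuity-type requirement on a functional under which, together with G(1)–G(3), it is the Green functional of an (essentially unique) thermal process with values in $H^*$; its explicit form is not fixed here, and it enters only as a hypothesis, not in the conclusion. Weak $\Sigma$-measurability means that $\omega\mapsto\mathbf G^\beta(\omega,F)$ is $\Sigma$-measurable for each fixed argument $F$. *)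

theory Defs
  imports "HOL-Probability.Probability"
begin

section \<open>Nuclear spaces and nuclear riggings\<close>

definition hilbert_form :: "('a::real_vector \<Rightarrow> 'a \<Rightarrow> real) \<Rightarrow> bool" where
  "hilbert_form b \<longleftrightarrow> bilinear b \<and> (\<forall>x y. b x y = b y x) \<and> (\<forall>x. 0 \<le> b x x)"

text \<open>
  A form \<open>b\<close> stands for the Hilbertian seminorm \<open>p x = sqrt (b x x)\<close>; write \<open>H\<^sub>b\<close> for the
  Hilbert space obtained from it by separation and completion.  The first condition says that
  \<open>H\<^sub>c \<rightarrow> H\<^sub>b\<close> is a well-defined contraction.  The second says that this map is
  Hilbert-Schmidt: \<open>C\<close> bounds the squared Hilbert-Schmidt norm, computed as a supremum over
  finite \<open>c\<close>-orthonormal systems, which may be taken in the dense image of the original space.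
\<close>

definition hilbert_schmidt_below ::
  "('a::real_vector \<Rightarrow> 'a \<Rightarrow> real) \<Rightarrow> ('a \<Rightarrow> 'a \<Rightarrow> real) \<Rightarrow> bool" where
  "hilbert_schmidt_below b c \<longleftrightarrow>
     (\<forall>x. b x x \<le> c x x) \<and>
     (\<exists>C. \<forall>S. finite S \<longrightarrow> (\<forall>x\<in>S. \<forall>y\<in>S. c x y = (if x = y then 1 else 0)) \<longrightarrow>
            (\<Sum>x\<in>S. b x x) \<le> C)"

text \<open>
  The topology is generated by a directed family of Hilbertian seminorms, each of which is
  dominated in the Hilbert-Schmidt sense by another one.  Compatibility of the topology with the
  vector space structure and local convexity follow from this; Hausdorffness is part of the sort constraint.
\<close>

definition nuclear_space :: "'a::{real_vector, t2_space} itself \<Rightarrow> bool" where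
  "nuclear_space (_ :: 'a itself) \<longleftrightarrow>
     (\<exists>B :: ('a \<Rightarrow> 'a \<Rightarrow> real) set.
       B \<noteq> {} \<and> (\<forall>b\<in>B. hilbert_form b) \<and>
       (\<forall>b\<in>B. \<forall>c\<in>B. \<exists>d\<in>B. \<forall>x. b x x \<le> d x x \<and> c x x \<le> d x x) \<and>
       (\<forall>U. open U \<longleftrightarrow> (\<forall>x\<in>U. \<exists>b\<in>B. \<exists>e>0. \<forall>y. b (y - x) (y - x) < e \<longrightarrow> y \<in> U)) \<and>
       (\<forall>b\<in>B. \<exists>c\<in>B. hilbert_schmidt_below b c))"

definition nuclear_dual :: "('n::{real_vector, t2_space} \<Rightarrow> real) set" where
  "nuclear_dual = {\<phi>. linear \<phi> \<and> continuous_on UNIV \<phi>}"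

text \<open>
  The rigging is given by the embedding \<open>\<iota>\<close> of the nuclear space into \<open>H\<close>; the other arrow,
  from \<open>H\<close> to the dual, is the transpose \<open>h \<mapsto> (\<lambda>f. h \<bullet> \<iota> f)\<close>.
\<close>

definition nuclear_rigging ::
  "('n::{real_vector, t2_space} \<Rightarrow> 'h::{real_inner, complete_space}) \<Rightarrow> bool" where
  "nuclear_rigging \<iota> \<longleftrightarrow>
     nuclear_space TYPE('n) \<and>
     linear \<iota> \<and> inj \<iota> \<and> continuous_on UNIV \<iota> \<and> closure (range \<iota>) = UNIV"

section \<open>Functions on the circle and the algebraic tensor product\<close>

text \<open>
  A function on the circle \<open>K\<^sub>\<beta>\<close> is represented by its \<open>\<beta>\<close>-periodic lift to the real line.
  For continuous functions this is the same as a continuous function on \<open>[-\<beta>/2, \<beta>/2]\<close> with equal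
  values at the end points, and reflection and shifts modulo \<open>\<beta>\<close> become \<open>s \<mapsto> -s\<close> and
  \<open>s \<mapsto> s - t\<close>.
\<close>

definition on_circle :: "real \<Rightarrow> (real \<Rightarrow> 'a) \<Rightarrow> bool" where
  "on_circle \<beta> u \<longleftrightarrow> (\<forall>s. u (s + \<beta>) = u s)"

definition C_circle :: "real \<Rightarrow> (real \<Rightarrow> real) set" where
  "C_circle \<beta> = {\<psi>. on_circle \<beta> \<psi> \<and> continuous_on UNIV \<psi>}"

text \<open>
  The complement of the closed arc \<open>[0, \<beta>/2]\<close> in the circle is the open arc \<open>(-\<beta>/2, 0)\<close>, since
  the end points \<open>-\<beta>/2\<close> and \<open>\<beta>/2\<close> are identified.
\<close>

definition C_circle_half :: "real \<Rightarrow> (real \<Rightarrow> real) set" where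
  "C_circle_half \<beta> = {\<psi> \<in> C_circle \<beta>. \<forall>s\<in>{-\<beta>/2<..<0}. \<psi> s = 0}"

text \<open>
  The algebraic tensor product of \<open>C_circle \<beta>\<close> with a vector space \<open>V\<close> is realised, through its
  canonical injection, as a space of \<open>V\<close>-valued functions on the circle.  Differences of tensors
  are then pointwise differences of functions, and an operator on functions on the circle, applied
  to the first factor, is the same substitution applied to the \<open>V\<close>-valued function.
\<close>

definition tensor :: "(real \<Rightarrow> real) \<Rightarrow> 'n::real_vector \<Rightarrow> (real \<Rightarrow> 'n)"  (infix "\<otimes>\<^sub>K" 75) where
  "\<psi> \<otimes>\<^sub>K f = (\<lambda>s. \<psi> s *\<^sub>R f)"

definition tensors :: "real \<Rightarrow> (real \<Rightarrow> 'n::real_vector) set" where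
  "tensors \<beta> = {F. \<exists>(n::nat) \<psi> f. (\<forall>k<n. \<psi> k \<in> C_circle \<beta>) \<and>
                        F = (\<lambda>s. \<Sum>k<n. (\<psi> k \<otimes>\<^sub>K f k) s)}"

definition reflect :: "(real \<Rightarrow> 'a) \<Rightarrow> (real \<Rightarrow> 'a)" where
  "reflect u = (\<lambda>s. u (- s))"

definition shift :: "real \<Rightarrow> (real \<Rightarrow> 'a) \<Rightarrow> (real \<Rightarrow> 'a)" where
  "shift t u = (\<lambda>s. u (s - t))"

section \<open>Thermal processes and their Green functionals\<close>

text \<open>
  The pairing \<open>\<integral> \<langle>\<zeta>\<^sub>\<tau>, F \<tau>\<rangle> d\<tau>\<close> of a path with a tensor.  For \<open>F = \<psi> \<otimes>\<^sub>K f\<close> and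
  a path of linear functionals it is \<open>\<integral> \<psi>(\<tau>) \<langle>\<zeta>\<^sub>\<tau>, f\<rangle> d\<tau>\<close>, and it is the linear extension of
  this expression to sums of simple tensors.
\<close>

definition path_pairing :: "real \<Rightarrow> (real \<Rightarrow> 'n \<Rightarrow> real) \<Rightarrow> (real \<Rightarrow> 'n) \<Rightarrow> real" where
  "path_pairing \<beta> \<zeta> F = (LINT \<tau>|lebesgue_on {-\<beta>/2..\<beta>/2}. \<zeta> \<tau> (F \<tau>))"

text \<open>
  A thermal process is given by its path space measure, the process itself being the coordinate
  process \<open>\<zeta>\<^sub>\<tau> = \<zeta> \<tau>\<close>.  The sigma-algebra on path space is not fixed: it may be any one for
  which the required functions are measurable, so a process on an arbitrary probability space
  yields such a measure (push forward along the path map, with the largest sigma-algebra making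
  that map measurable).  The last two conditions say that the integral in the exponent of the
  Green functional exists and is a random variable.
\<close>

definition thermal_process :: "real \<Rightarrow> (real \<Rightarrow> 'n::{real_vector, t2_space} \<Rightarrow> real) measure \<Rightarrow> bool" where
  "thermal_process \<beta> M \<longleftrightarrow>
     prob_space M \<and>
     (AE \<zeta> in M. on_circle \<beta> \<zeta> \<and> (\<forall>\<tau>. \<zeta> \<tau> \<in> nuclear_dual)) \<and>
     (\<forall>\<tau> f. (\<lambda>\<zeta>. \<zeta> \<tau> f) \<in> borel_measurable M) \<and>
     (\<forall>F\<in>tensors \<beta>. AE \<zeta> in M. integrable (lebesgue_on {-\<beta>/2..\<beta>/2}) (\<lambda>\<tau>. \<zeta> \<tau> (F \<tau>))) \<and>
     (\<forall>F\<in>tensors \<beta>. (\<lambda>\<zeta>. path_pairing \<beta> \<zeta> F) \<in> borel_measurable M)"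

text \<open>Functionals are only meaningful on \<open>tensors \<beta>\<close>; their values elsewhere are irrelevant.\<close>

definition green_functional :: "real \<Rightarrow> ((real \<Rightarrow> 'n::{real_vector, t2_space}) \<Rightarrow> complex) \<Rightarrow> bool" where
  "green_functional \<beta> g \<longleftrightarrow>
     (\<exists>M. thermal_process \<beta> M \<and>
          (\<forall>F\<in>tensors \<beta>. g F = (LINT \<zeta>|M. exp (\<i> * of_real (path_pairing \<beta> \<zeta> F)))))"

section \<open>Properties of functionals\<close>

definition S_positive :: "real \<Rightarrow> ((real \<Rightarrow> 'n::real_vector) \<Rightarrow> complex) \<Rightarrow> bool" where
  "S_positive \<beta> g \<longleftrightarrow>
     (\<forall>(n::nat) (c :: nat \<Rightarrow> complex) (\<psi> :: nat \<Rightarrow> real \<Rightarrow> real) (f :: nat \<Rightarrow> 'n).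
        (\<forall>\<alpha><n. \<psi> \<alpha> \<in> C_circle \<beta>) \<longrightarrow>
        (\<Sum>\<alpha><n. \<Sum>\<gamma><n. cnj (c \<alpha>) * c \<gamma> * g (\<psi> \<alpha> \<otimes>\<^sub>K f \<alpha> - \<psi> \<gamma> \<otimes>\<^sub>K f \<gamma>)) \<in> \<real>\<^sub>\<ge>\<^sub>0)"

definition reflection_positive :: "real \<Rightarrow> ((real \<Rightarrow> 'n::real_vector) \<Rightarrow> complex) \<Rightarrow> bool" where
  "reflection_positive \<beta> g \<longleftrightarrow>
     (\<forall>(n::nat) (c :: nat \<Rightarrow> complex) (\<psi> :: nat \<Rightarrow> real \<Rightarrow> real) (f :: nat \<Rightarrow> 'n).
        (\<forall>\<alpha><n. \<psi> \<alpha> \<in> C_circle_half \<beta>) \<longrightarrow>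
        (\<Sum>\<alpha><n. \<Sum>\<gamma><n. cnj (c \<alpha>) * c \<gamma> *
            g (\<psi> \<alpha> \<otimes>\<^sub>K f \<alpha> - reflect (\<psi> \<gamma>) \<otimes>\<^sub>K f \<gamma>)) \<in> \<real>\<^sub>\<ge>\<^sub>0)"

text \<open>
  The third clause is \<open>\<beta>\<close>-periodicity of \<open>t \<mapsto> g (shift t F)\<close>.  It holds automatically on the
  circle, where shifts are taken modulo \<open>\<beta>\<close>, and is kept as a separate property.
\<close>

definition circle_invariant :: "real \<Rightarrow> ((real \<Rightarrow> 'n::real_vector) \<Rightarrow> complex) \<Rightarrow> bool" where
  "circle_invariant \<beta> g \<longleftrightarrow>
     (\<forall>F\<in>tensors \<beta>. g (reflect F) = g F) \<and>
     (\<forall>F\<in>tensors \<beta>. \<forall>t. g (shift t F) = g F) \<and>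
     (\<forall>F\<in>tensors \<beta>. \<forall>t. g (shift (t + \<beta>) F) = g (shift t F))"

text \<open>
  A regularity condition is a property of functionals under which, together with the three
  properties above, the functional is the Green functional of a thermal process.  The parameter
  \<open>\<kappa>\<close> stands for the constants (bounds, moduli of continuity) occurring in it: a single functional
  is regular if \<open>Reg \<kappa> g\<close> for some \<open>\<kappa>\<close>, a family is uniformly regular if one \<open>\<kappa>\<close> serves all its
  members.
\<close>

definition regularity_condition ::
  "real \<Rightarrow> ('c \<Rightarrow> ((real \<Rightarrow> 'n::{real_vector, t2_space}) \<Rightarrow> complex) \<Rightarrow> bool) \<Rightarrow> bool" where
  "regularity_condition \<beta> Reg \<longleftrightarrow>
     (\<forall>\<kappa> g. Reg \<kappa> g \<and> S_positive \<beta> g \<and> reflection_positive \<beta> g \<and> circle_invariant \<beta> g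
            \<longrightarrow> green_functional \<beta> g)"

definition averaged_functional ::
  "'w measure \<Rightarrow> ('w \<Rightarrow> (real \<Rightarrow> 'n) \<Rightarrow> complex) \<Rightarrow> (real \<Rightarrow> 'n) \<Rightarrow> complex" where
  "averaged_functional P G F = (LINT \<omega>|P. G \<omega> F)"

end

theory Submission
  imports Defs
begin

text \<open>
  The three properties consist of closed linear conditions on the values of a functional at
  tensors, so they survive averaging as soon as all these values are integrable over \<open>\<Omega>\<close>.
  Integrability holds because a Green functional, being an average of phases, is bounded by 1.
\<close>

lemma C_circle_reflect: "\<psi> \<in> C_circle \<beta> \<Longrightarrow> reflect \<psi> \<in> C_circle \<beta>"
proof -
  assume \<psi>: "\<psi> \<in> C_circle \<beta>"
  then have per: "\<psi> (s + \<beta>) = \<psi> s" and cont: "continuous_on UNIV \<psi>" for s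
    by (auto simp: C_circle_def on_circle_def)
  have "\<psi> (- (s + \<beta>)) = \<psi> (- s)" for s
    \<comment> \<open>Reflection reverses translations, so the period is added at the point
      \<open>- s - \<beta>\<close>, that is, the equation is read from right to left.\<close>
    using per[of "- s - \<beta>"] by simp
  moreover have "continuous_on UNIV (\<lambda>s. \<psi> (- s))"
    by (rule continuous_on_compose2[OF cont]) (auto intro!: continuous_intros)
  ultimately show ?thesis
    by (simp add: C_circle_def on_circle_def reflect_def)
qed

lemma C_circle_shift: "\<psi> \<in> C_circle \<beta> \<Longrightarrow> shift t \<psi> \<in> C_circle \<beta>"
proof -
  assume \<psi>: "\<psi> \<in> C_circle \<beta>"
  then have per: "\<psi> (s + \<beta>) = \<psi> s" and cont: "continuous_on UNIV \<psi>" for s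
    by (auto simp: C_circle_def on_circle_def)
  have "\<psi> (s + \<beta> - t) = \<psi> (s - t)" for s
    using per[of "s - t"] by (simp add: algebra_simps)
  moreover have "continuous_on UNIV (\<lambda>s. \<psi> (s - t))"
    by (rule continuous_on_compose2[OF cont]) (auto intro!: continuous_intros)
  ultimately show ?thesis
    by (simp add: C_circle_def on_circle_def shift_def)
qed

text \<open>Reflection acts on the circle variable alone, so it passes through the sum and
  transforms each first factor. With \<open>tensors_shift\<close>, this keeps the transformed
  arguments among those where measurability and the bound by 1 are available.\<close>

lemma tensors_reflect: "F \<in> tensors \<beta> \<Longrightarrow> reflect F \<in> tensors \<beta>"
proof -
  assume "F \<in> tensors \<beta>"
  then obtain n :: nat and \<psi> f where "\<forall>k<n. \<psi> k \<in> C_circle \<beta>" "F = (\<lambda>s. \<Sum>k<n. (\<psi> k \<otimes>\<^sub>K f k) s)"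
    by (auto simp: tensors_def)
  then show ?thesis
    unfolding tensors_def
    by (intro CollectI exI[of _ n] exI[of _ "\<lambda>k. reflect (\<psi> k)"] exI[of _ f])
       (auto simp: reflect_def tensor_def intro: C_circle_reflect[unfolded reflect_def])
qed

lemma tensors_shift: "F \<in> tensors \<beta> \<Longrightarrow> shift t F \<in> tensors \<beta>"
proof -
  assume "F \<in> tensors \<beta>"
  then obtain n :: nat and \<psi> f where "\<forall>k<n. \<psi> k \<in> C_circle \<beta>" "F = (\<lambda>s. \<Sum>k<n. (\<psi> k \<otimes>\<^sub>K f k) s)"
    by (auto simp: tensors_def)
  then show ?thesis
    unfolding tensors_def
    by (intro CollectI exI[of _ n] exI[of _ "\<lambda>k. shift t (\<psi> k)"] exI[of _ f])
       (auto simp: shift_def tensor_def intro: C_circle_shift[unfolded shift_def])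
qed

text \<open>The minus sign is absorbed into the vector factor, which leaves a sum of two simple
  tensors. These are the arguments at which both positivity conditions evaluate a
  functional.\<close>

lemma tensors_diff_simple:
  assumes "\<phi> \<in> C_circle \<beta>" "\<psi> \<in> C_circle \<beta>"
  shows "\<phi> \<otimes>\<^sub>K f - \<psi> \<otimes>\<^sub>K g \<in> tensors \<beta>"
  unfolding tensors_def
  using assms
  by (intro CollectI exI[of _ 2] exI[of _ "\<lambda>k. if k = 0 then \<phi> else \<psi>"]
        exI[of _ "\<lambda>k. if k = 0 then f else - g"])
     (auto simp: tensor_def numeral_2_eq_2)

lemma green_functional_norm_le_1:
  assumes "green_functional \<beta> g" "F \<in> tensors \<beta>"
  shows "norm (g F) \<le> 1"
proof -
  from assms obtain M where M: "prob_space M"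
    and g: "g F = (LINT \<zeta>|M. exp (\<i> * of_real (path_pairing \<beta> \<zeta> F)))"
    by (auto simp: green_functional_def thermal_process_def)
  interpret prob_space M by (rule M)
  \<comment> \<open>The exponent is purely imaginary, so the integrand on the right is the constant
    1. The inequality also covers a non-integrable phase, whose integral is 0 by convention.\<close>
  have "norm (g F) \<le> (LINT \<zeta>|M. norm (exp (\<i> * of_real (path_pairing \<beta> \<zeta> F))))"
    unfolding g by (rule integral_norm_bound)
  then show ?thesis
    by (simp add: prob_space)
qed

text \<open>Almost everywhere \<open>h\<close> equals its real part embedded in the complex numbers,
  which reduces the claim to positivity of a real integral. A non-integrable \<open>h\<close> is
  covered too: its integral is 0.\<close>

lemma integral_nonneg_Reals_AE:
  fixes h :: "'a \<Rightarrow> complex"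
  assumes "h \<in> borel_measurable M" "AE x in M. h x \<in> \<real>\<^sub>\<ge>\<^sub>0"
  shows "integral\<^sup>L M h \<in> \<real>\<^sub>\<ge>\<^sub>0"
proof -
  have "integral\<^sup>L M h = (LINT x|M. complex_of_real (Re (h x)))"
    using assms by (intro integral_cong_AE) (auto simp: complex_nonneg_Reals_iff complex_eq_iff)
  also have "\<dots> = complex_of_real (LINT x|M. Re (h x))"
    by (rule integral_complex_of_real)
  also have "\<dots> \<in> \<real>\<^sub>\<ge>\<^sub>0"
    using assms(2) by (auto intro!: integral_nonneg_AE simp: complex_nonneg_Reals_iff)
  finally show ?thesis .
qed

text \<open>S-positivity and reflection positivity concern the same quadratic form and differ only
  in the matrix \<open>F\<close> of tensors. Integrability of the entries lets the finite sums pass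
  through the integral, so the form of the average is the average of the forms.\<close>

lemma averaged_form_nonneg:
  fixes G :: "'w \<Rightarrow> (real \<Rightarrow> 'n) \<Rightarrow> complex" and n :: nat
  assumes int: "\<And>\<alpha> \<gamma>. \<alpha> < n \<Longrightarrow> \<gamma> < n \<Longrightarrow> integrable P (\<lambda>\<omega>. G \<omega> (F \<alpha> \<gamma>))"
    and pos: "AE \<omega> in P. (\<Sum>\<alpha><n. \<Sum>\<gamma><n. cnj (c \<alpha>) * c \<gamma> * G \<omega> (F \<alpha> \<gamma>)) \<in> \<real>\<^sub>\<ge>\<^sub>0"
  shows "(\<Sum>\<alpha><n. \<Sum>\<gamma><n. cnj (c \<alpha>) * c \<gamma> * averaged_functional P G (F \<alpha> \<gamma>)) \<in> \<real>\<^sub>\<ge>\<^sub>0"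
proof -
  let ?q = "\<lambda>\<omega>. \<Sum>\<alpha><n. \<Sum>\<gamma><n. cnj (c \<alpha>) * c \<gamma> * G \<omega> (F \<alpha> \<gamma>)"
  have "integrable P ?q"
    using int by (intro Bochner_Integration.integrable_sum integrable_mult_right) auto
  then have "integral\<^sup>L P ?q \<in> \<real>\<^sub>\<ge>\<^sub>0"
    using pos by (intro integral_nonneg_Reals_AE) auto
  moreover have "integral\<^sup>L P ?q =
      (\<Sum>\<alpha><n. \<Sum>\<gamma><n. cnj (c \<alpha>) * c \<gamma> * averaged_functional P G (F \<alpha> \<gamma>))"
  proof -
    have "integral\<^sup>L P ?q = (\<Sum>\<alpha><n. (LINT \<omega>|P. (\<Sum>\<gamma><n. cnj (c \<alpha>) * c \<gamma> * G \<omega> (F \<alpha> \<gamma>))))"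
      using int
      by (intro Bochner_Integration.integral_sum Bochner_Integration.integrable_sum
          integrable_mult_right) auto
    also have "\<dots> = (\<Sum>\<alpha><n. \<Sum>\<gamma><n. (LINT \<omega>|P. cnj (c \<alpha>) * c \<gamma> * G \<omega> (F \<alpha> \<gamma>)))"
      using int
      by (intro sum.cong refl Bochner_Integration.integral_sum integrable_mult_right) auto
    finally show ?thesis
      by (simp add: averaged_functional_def)
  qed
  ultimately show ?thesis
    by simp
qed

theorem proposition2p4:
  fixes \<beta> :: real
    and \<iota> :: "'n::{real_vector, t2_space} \<Rightarrow> 'h::{real_inner, complete_space}"
    and P :: "'w measure"
    and G :: "'w \<Rightarrow> (real \<Rightarrow> 'n) \<Rightarrow> complex"
    and Reg :: "'c \<Rightarrow> ((real \<Rightarrow> 'n) \<Rightarrow> complex) \<Rightarrow> bool"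
  assumes "0 < \<beta>"
    and "\<exists>D :: 'h set. countable D \<and> closure D = UNIV"
    and "nuclear_rigging \<iota>"
    and "prob_space P"
    and "\<forall>\<omega>\<in>space P. green_functional \<beta> (G \<omega>)"
    and "\<forall>F\<in>tensors \<beta>. (\<lambda>\<omega>. G \<omega> F) \<in> borel_measurable P"
    and "AE \<omega> in P. S_positive \<beta> (G \<omega>) \<and> reflection_positive \<beta> (G \<omega>) \<and> circle_invariant \<beta> (G \<omega>)"
    and "regularity_condition \<beta> Reg"
    and "\<exists>\<kappa>. AE \<omega> in P. Reg \<kappa> (G \<omega>)"
  shows "S_positive \<beta> (averaged_functional P G) \<and>
         reflection_positive \<beta> (averaged_functional P G) \<and>
         circle_invariant \<beta> (averaged_functional P G)"
proof (intro conjI)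
  interpret prob_space P by fact
  have meas: "(\<lambda>\<omega>. G \<omega> F) \<in> borel_measurable P" if "F \<in> tensors \<beta>" for F
    using assms(6) that by blast
  have int: "integrable P (\<lambda>\<omega>. G \<omega> F)" if "F \<in> tensors \<beta>" for F
    using assms(5) that
    by (intro integrable_const_bound[where B = 1] meas AE_I2) (auto intro: green_functional_norm_le_1)
  have AE_S: "AE \<omega> in P. S_positive \<beta> (G \<omega>)"
    and AE_R: "AE \<omega> in P. reflection_positive \<beta> (G \<omega>)"
    and AE_I: "AE \<omega> in P. circle_invariant \<beta> (G \<omega>)"
    using assms(7) by auto

  show "S_positive \<beta> (averaged_functional P G)"
    unfolding S_positive_def
  proof (intro allI impI)
    fix n :: nat and c :: "nat \<Rightarrow> complex" and \<psi> :: "nat \<Rightarrow> real \<Rightarrow> real" and f :: "nat \<Rightarrow> 'n"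
    assume \<psi>: "\<forall>\<alpha><n. \<psi> \<alpha> \<in> C_circle \<beta>"
    show "(\<Sum>\<alpha><n. \<Sum>\<gamma><n. cnj (c \<alpha>) * c \<gamma> *
        averaged_functional P G (\<psi> \<alpha> \<otimes>\<^sub>K f \<alpha> - \<psi> \<gamma> \<otimes>\<^sub>K f \<gamma>)) \<in> \<real>\<^sub>\<ge>\<^sub>0"
    proof (rule averaged_form_nonneg)
      \<comment> \<open>\<open>S_positive\<close> quantifies over all coefficients and tensors
        inside the almost-everywhere statement, so a single null set serves every choice of
        \<open>n\<close>, \<open>c\<close>, \<open>\<psi>\<close> and \<open>f\<close>.\<close>
      show "AE \<omega> in P. (\<Sum>\<alpha><n. \<Sum>\<gamma><n. cnj (c \<alpha>) * c \<gamma> *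
          G \<omega> (\<psi> \<alpha> \<otimes>\<^sub>K f \<alpha> - \<psi> \<gamma> \<otimes>\<^sub>K f \<gamma>)) \<in> \<real>\<^sub>\<ge>\<^sub>0"
        using AE_S by eventually_elim (use \<psi> in \<open>simp add: S_positive_def\<close>)
    qed (use \<psi> in \<open>auto intro: int tensors_diff_simple\<close>)
  qed

  show "reflection_positive \<beta> (averaged_functional P G)"
    unfolding reflection_positive_def
  proof (intro allI impI)
    fix n :: nat and c :: "nat \<Rightarrow> complex" and \<psi> :: "nat \<Rightarrow> real \<Rightarrow> real" and f :: "nat \<Rightarrow> 'n"
    assume \<psi>: "\<forall>\<alpha><n. \<psi> \<alpha> \<in> C_circle_half \<beta>"
    \<comment> \<open>Reflection moves the support to the opposite arc, so integrability of the
      entries is argued in \<open>C_circle\<close>, which reflection preserves. The support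
      condition enters through the positivity of each \<open>G \<omega>\<close>.\<close>
    then have \<psi>': "\<psi> \<alpha> \<in> C_circle \<beta>" if "\<alpha> < n" for \<alpha>
      using that by (simp add: C_circle_half_def)
    show "(\<Sum>\<alpha><n. \<Sum>\<gamma><n. cnj (c \<alpha>) * c \<gamma> *
        averaged_functional P G (\<psi> \<alpha> \<otimes>\<^sub>K f \<alpha> - reflect (\<psi> \<gamma>) \<otimes>\<^sub>K f \<gamma>)) \<in> \<real>\<^sub>\<ge>\<^sub>0"
    proof (rule averaged_form_nonneg)
      show "AE \<omega> in P. (\<Sum>\<alpha><n. \<Sum>\<gamma><n. cnj (c \<alpha>) * c \<gamma> *
          G \<omega> (\<psi> \<alpha> \<otimes>\<^sub>K f \<alpha> - reflect (\<psi> \<gamma>) \<otimes>\<^sub>K f \<gamma>)) \<in> \<real>\<^sub>\<ge>\<^sub>0"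
        using AE_R by eventually_elim (use \<psi> in \<open>simp add: reflection_positive_def\<close>)
    qed (auto intro: int tensors_diff_simple C_circle_reflect \<psi>')
  qed

  \<comment> \<open>Every invariance clause equates the values of a functional at two tensors.
    Quantifying over an arbitrary invariant \<open>g\<close> lets each clause be read off the
    definition and then applied to almost every \<open>G \<omega>\<close>.\<close>
  have avg_eq: "averaged_functional P G F = averaged_functional P G F'"
    if "F \<in> tensors \<beta>" "F' \<in> tensors \<beta>" "\<And>g. circle_invariant \<beta> g \<Longrightarrow> g F = g F'" for F F'
    unfolding averaged_functional_def
  proof (rule integral_cong_AE)
    show "AE \<omega> in P. G \<omega> F = G \<omega> F'"
      using AE_I by eventually_elim (rule that(3))
  qed (use that meas in auto)
  show "circle_invariant \<beta> (averaged_functional P G)"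
    unfolding circle_invariant_def
    by (intro conjI ballI allI avg_eq tensors_reflect tensors_shift)
       (simp_all add: circle_invariant_def)
qed

end
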